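(* For every integer $k\ge 4$ there exists $c>0$ such that for all sufficiently large $t$, $$r_k(t;3,3)\ge T_{k-1}(t^c).$$
   Context: $K_n^{(k)}$ is the complete $k$-uniform hypergraph on $n$ vertices. For integers $q\ge p$, $r_k(t;q,p)$ is the smallest integer $n$ such that in every colouring of the edges of $K_n^{(k)}$ with $q$ colours there is a set of $t$ vertices such that the $k$-edges contained in it receive fewer than $p$ distinct colours in total. The tower function is defined by $T_1(x)=x$ and $T_{i+1}(x)=2^{T_i(x)}$. *)

theory Defs
  imports Complex_Main "HOL-Library.Ramsey"
begin

text \<open>
  The vertex set of the complete \<open>k\<close>-uniform hypergraph on \<open>n\<close> vertices is \<open>{..<n}\<close>, its edge set
  is \<open>[{..<n}]\<^bsup>k\<^esup>\<close>, and the \<open>q\<close> colours are \<open>{..<q}\<close>; a colouring need not use all of them.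
\<close>

definition ramsey_arrow :: "nat \<Rightarrow> nat \<Rightarrow> nat \<Rightarrow> nat \<Rightarrow> nat \<Rightarrow> bool" where
  "ramsey_arrow k n t q p \<longleftrightarrow>
     (\<forall>\<chi> \<in> [{..<n}]\<^bsup>k\<^esup> \<rightarrow> {..<q}. \<exists>S \<in> [{..<n}]\<^bsup>t\<^esup>. card (\<chi> ` [S]\<^bsup>k\<^esup>) < p)"

text \<open>
  The minimum below is over a nonempty set as soon as \<open>p \<ge> 2\<close>, by Ramsey's theorem
  (lemma \<open>ramsey_arrow_exists\<close>).
\<close>

definition ramsey_num :: "nat \<Rightarrow> nat \<Rightarrow> nat \<Rightarrow> nat \<Rightarrow> nat" where
  "ramsey_num k t q p = (LEAST n. ramsey_arrow k n t q p)"

lemma ramsey_arrow_exists: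
  assumes "p \<ge> 2"
  shows "\<exists>n. ramsey_arrow k n t q p"
proof -
  obtain N :: nat where N: "partn_lst {..<N} (replicate q t) k"
    using ramsey_full by blast
  have "ramsey_arrow k N t q p"
    unfolding ramsey_arrow_def
  proof
    fix \<chi> :: "nat set \<Rightarrow> nat" assume "\<chi> \<in> [{..<N}]\<^bsup>k\<^esup> \<rightarrow> {..<q}"
    then obtain i S where S: "S \<in> [{..<N}]\<^bsup>t\<^esup>" "\<chi> ` [S]\<^bsup>k\<^esup> \<subseteq> {i}"
      using N by (force simp: partn_lst_def monochromatic_def)
    have "card (\<chi> ` [S]\<^bsup>k\<^esup>) \<le> card {i}"
      using S by (intro card_mono) auto
    then show "\<exists>S \<in> [{..<N}]\<^bsup>t\<^esup>. card (\<chi> ` [S]\<^bsup>k\<^esup>) < p"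
      using S assms by force
  qed
  then show ?thesis ..
qed

text \<open>The index of the tower function starts at \<open>1\<close>; \<open>tower 0\<close> is left unspecified.\<close>

fun tower :: "nat \<Rightarrow> real \<Rightarrow> real" where
  "tower (Suc 0) x = x"
| "tower (Suc (Suc i)) x = 2 powr tower (Suc i) x"

end

theory Submission
  imports Defs
begin

text \<open>
  A random 3-colouring of the triples of a set of size \<open>2 ^ t\<close> uses all three colours on every
  \<open>t\<close>-subset. Such colourings are then stepped up from \<open>k\<close>-sets of \<open>{..<m}\<close> to \<open>(k + 1)\<close>-sets of
  \<open>{..<2 ^ m}\<close>, as by Erdos and Hajnal, with \<open>delta x y\<close> the highest binary digit where \<open>x\<close> and
  \<open>y\<close> differ. Edges with monotone consecutive \<open>delta\<close> are coloured by the old colouring of their set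
  of \<open>delta\<close>s; all others by the order type of the \<open>delta\<close>s of their first four vertices, where
  three types occur that are neither increasing nor decreasing. A set of more than \<open>t\<^sup>2\<close> points
  contains either \<open>t + 1\<close> points with monotone \<open>delta\<close>s or all three types, so \<open>t\<close> grows only
  polynomially while \<open>m\<close> is exponentiated.
\<close>

section \<open>Highest differing binary digit\<close>

text \<open>Phrased through equal quotients, so that bounds on \<open>delta\<close> become
  equations. Digits count from 0, and \<open>delta x x = 0\<close> is only a default.\<close>

definition delta :: "nat \<Rightarrow> nat \<Rightarrow> nat" where
  "delta x y = (LEAST d. x div 2 ^ Suc d = y div 2 ^ Suc d)"

lemma delta_le_iff: "delta x y \<le> d \<longleftrightarrow> x div 2 ^ Suc d = y div 2 ^ Suc d"
proof
  \<comment> \<open>Both quotients vanish at \<open>x + y\<close>, so the set under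
    \<open>LEAST\<close> is nonempty.\<close>
  have "x < 2 ^ Suc (x + y)" "y < 2 ^ Suc (x + y)"
    using less_exp[of "Suc (x + y)"] by linarith+
  then have ex: "x div 2 ^ Suc (x + y) = y div 2 ^ Suc (x + y)" by simp
  have least: "x div 2 ^ Suc (delta x y) = y div 2 ^ Suc (delta x y)"
    unfolding delta_def by (rule LeastI[where P = "\<lambda>d. x div 2 ^ Suc d = y div 2 ^ Suc d", OF ex])
  assume "delta x y \<le> d"
  then obtain i where d: "d = delta x y + i" using le_Suc_ex by blast
  have "z div 2 ^ Suc d = z div 2 ^ Suc (delta x y) div 2 ^ i" for z :: nat
    by (simp add: d power_add div_mult2_eq)
  with least show "x div 2 ^ Suc d = y div 2 ^ Suc d" by metis
qed (simp add: delta_def Least_le)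

lemma delta_less:
  assumes "x < y" "y < 2 ^ m"
  shows "delta x y < m"
proof (cases m)
  case (Suc d)
  then have "delta x y \<le> d" using assms by (simp add: delta_le_iff del: power_Suc)
  then show ?thesis using Suc by simp
qed (use assms in simp)

text \<open>Quotients are monotone, so those of \<open>x\<close> and \<open>z\<close> agree exactly
  when that of \<open>y\<close> agrees with both.\<close>

lemma delta_trans:
  assumes "x < y" "y < z"
  shows "delta x z = max (delta x y) (delta y z)"
proof -
  have "delta x z \<le> d \<longleftrightarrow> max (delta x y) (delta y z) \<le> d" for d
  proof -
    have "x div 2 ^ Suc d \<le> y div 2 ^ Suc d" "y div 2 ^ Suc d \<le> z div 2 ^ Suc d"
      using assms by (auto intro!: div_le_mono simp del: power_Suc)
    then show ?thesis by (auto simp: delta_le_iff simp del: power_Suc)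
  qed
  then show ?thesis by (metis order.refl order.antisym)
qed

text \<open>Otherwise dropping the lowest \<open>d\<close> digits would leave three strictly
  increasing numbers with the same half, but only two integers share a half.\<close>

lemma delta_neq:
  assumes "x < y" "y < z"
  shows "delta x y \<noteq> delta y z"
proof
  assume eq: "delta x y = delta y z"
  define d where "d = delta x y"
  have less: "u div 2 ^ d < v div 2 ^ d" if "u < v" "delta u v = d" for u v
  proof -
    have "u div 2 ^ d \<noteq> v div 2 ^ d"
    proof (cases d)
      case (Suc e)
      then show ?thesis using that delta_le_iff[of u v e] by auto
    qed (use that in simp)
    then show ?thesis using that(1) by (metis div_le_mono nat_less_le)
  qed
  have "x div 2 ^ Suc d = z div 2 ^ Suc d"
    using delta_le_iff[of x z d] delta_trans[OF assms] eq d_def by simp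
  then have "x div 2 ^ d div 2 = z div 2 ^ d div 2"
    by (simp add: div_mult2_eq mult.commute[of 2])
  then show False using less[of x y] less[of y z] assms eq d_def by linarith
qed

section \<open>Sets with monotone \<open>delta\<close>, and splitting at the top digit\<close>

text \<open>Asking for all triples, not only consecutive points, makes the property visibly pass to
  subsets. Sets of at most two points have it trivially, and likewise
  \<open>dec_delta\<close>.\<close>

definition inc_delta :: "nat set \<Rightarrow> bool" where
  "inc_delta C \<longleftrightarrow> (\<forall>x\<in>C. \<forall>y\<in>C. \<forall>z\<in>C. x < y \<and> y < z \<longrightarrow> delta x y < delta y z)"

definition dec_delta :: "nat set \<Rightarrow> bool" where
  "dec_delta C \<longleftrightarrow> (\<forall>x\<in>C. \<forall>y\<in>C. \<forall>z\<in>C. x < y \<and> y < z \<longrightarrow> delta y z < delta x y)"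

text \<open>All points of \<open>S\<close> agree above digit \<open>D\<close>; \<open>A\<close> and
  \<open>B\<close> collect those whose digit \<open>D\<close> is 0 and 1.\<close>

lemma delta_split:
  assumes "finite S" "2 \<le> card S"
  obtains A B D where "S = A \<union> B" "A \<inter> B = {}" "A \<noteq> {}" "B \<noteq> {}"
    "\<And>x y. x \<in> A \<Longrightarrow> y \<in> B \<Longrightarrow> x < y \<and> delta x y = D"
    "\<And>x y. x \<in> A \<Longrightarrow> y \<in> A \<Longrightarrow> x < y \<Longrightarrow> delta x y < D"
    "\<And>x y. x \<in> B \<Longrightarrow> y \<in> B \<Longrightarrow> x < y \<Longrightarrow> delta x y < D"
proof -
  define l where "l = Min S"
  define h where "h = Max S"
  define D where "D = delta l h"
  \<comment> \<open>\<open>x = l\<close> is listed separately because \<open>delta l l = 0\<close>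
    is not below \<open>D\<close> when \<open>D = 0\<close>.\<close>
  define A where "A = {x \<in> S. x = l \<or> delta l x < D}"
  have ne: "S \<noteq> {}" using assms by auto
  have l: "l \<in> S" "\<And>x. x \<in> S \<Longrightarrow> l \<le> x" using ne assms(1) by (auto simp: l_def)
  have h: "h \<in> S" "\<And>x. x \<in> S \<Longrightarrow> x \<le> h" using ne assms(1) by (auto simp: h_def)
  have "l \<noteq> h"
  proof
    assume "l = h"
    then have "S \<subseteq> {l}" using l h by (metis insertI1 order.antisym subsetI)
    then show False using assms(2) card_mono[of "{l}" S] by simp
  qed
  have le: "delta l x \<le> D" if "x \<in> S" "x \<noteq> l" for x
    using that l(2)[of x] h(2)[of x] delta_trans[of l x h] by (cases "x = h") (auto simp: D_def)
  have B: "x \<noteq> l \<and> l < x \<and> delta l x = D" if "x \<in> S - A" for x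
    using that le[of x] l(2)[of x] unfolding A_def by fastforce
  show thesis
  proof (rule that[of A "S - A" D])
    show "S = A \<union> (S - A)" by (auto simp: A_def)
    show "A \<noteq> {}" using l by (auto simp: A_def)
    show "S - A \<noteq> {}" using h \<open>l \<noteq> h\<close> by (auto simp: A_def D_def)
    show "x < y \<and> delta x y = D" if x: "x \<in> A" and y: "y \<in> S - A" for x y
    proof (cases "x = l")
      case True
      then show ?thesis using B[OF y] by simp
    next
      case False
      then have x': "delta l x < D" "l < x" using x l(2)[of x] by (auto simp: A_def)
      have "x \<noteq> y" using x y by auto
      moreover have "\<not> y < x" using delta_trans[of l y x] B[OF y] x' by auto
      ultimately have "x < y" by simp
      then show ?thesis using delta_trans[of l x y] B[OF y] x' by (auto simp: max_def split: if_splits)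
    qed
    show "delta x y < D" if x: "x \<in> A" and y: "y \<in> A" and "x < y" for x y
    proof (cases "x = l")
      case False
      then have "l < x" using x l(2)[of x] by (auto simp: A_def)
      then show ?thesis using delta_trans[of l x y] y \<open>x < y\<close> by (auto simp: A_def)
    qed (use y \<open>x < y\<close> in \<open>auto simp: A_def\<close>)
    show "delta x y < D" if x: "x \<in> S - A" and y: "y \<in> S - A" and "x < y" for x y
      using delta_trans[of l x y] delta_neq[of l x y] B[OF x] B[OF y] \<open>x < y\<close> by auto
  qed auto
qed

section \<open>The three non-monotone order types\<close>

text \<open>Type 0 is a peak in the middle; types 1 and 2 are valleys with the larger end first or
  last. The ends of a valley never tie, by \<open>delta_neq\<close> and \<open>delta_trans\<close>,
  so four increasing points either realise a type or have monotone \<open>delta\<close>.\<close>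

fun pattern :: "nat \<Rightarrow> nat \<Rightarrow> nat \<Rightarrow> nat \<Rightarrow> nat \<Rightarrow> bool" where
  "pattern i a b c d \<longleftrightarrow>
    (if i = 0 then delta a b < delta b c \<and> delta c d < delta b c
     else if i = 1 then delta b c < delta c d \<and> delta c d < delta a b
     else delta b c < delta a b \<and> delta a b < delta c d)"

definition has_pattern :: "nat \<Rightarrow> nat set \<Rightarrow> bool" where
  "has_pattern i S \<longleftrightarrow>
    (\<exists>w\<in>S. \<exists>x\<in>S. \<exists>y\<in>S. \<exists>z\<in>S. w < x \<and> x < y \<and> y < z \<and> pattern i w x y z)"

lemma has_patternI:
  "\<lbrakk>w \<in> S; x \<in> S; y \<in> S; z \<in> S; w < x; x < y; y < z; pattern i w x y z\<rbrakk> \<Longrightarrow> has_pattern i S"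
  unfolding has_pattern_def by blast

lemma has_pattern_mono: "has_pattern i A \<Longrightarrow> A \<subseteq> S \<Longrightarrow> has_pattern i S"
  unfolding has_pattern_def by (meson subsetD)

text \<open>
  The set \<open>S\<close> is split at its largest \<open>delta\<close>. Adding a point of the upper part to an increasing
  set of the lower part keeps it increasing, and dually for decreasing sets; avoiding a pattern
  makes one of the two parts a single point, or an increasing or decreasing set.
\<close>

lemma pattern_exists:
  assumes "finite S" "a * b < card S"
  shows "(\<exists>C\<subseteq>S. card C = Suc a \<and> inc_delta C) \<or> (\<exists>C\<subseteq>S. card C = Suc b \<and> dec_delta C) \<or>
    has_pattern i S"
  using assms
proof (induction "card S" arbitrary: S a b rule: less_induct)
  case less
  let ?I = "\<lambda>S a. \<exists>C\<subseteq>S. card C = Suc a \<and> inc_delta C"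
  let ?J = "\<lambda>S b. \<exists>C\<subseteq>S. card C = Suc b \<and> dec_delta C"
  show ?case
  proof (cases "a = 0 \<or> b = 0")
    case True
    obtain s where "s \<in> S" using less.prems by (metis card.empty ex_in_conv not_less_zero)
    then have "{s} \<subseteq> S \<and> card {s} = Suc 0 \<and> inc_delta {s} \<and> dec_delta {s}"
      by (auto simp: inc_delta_def dec_delta_def)
    then show ?thesis using True by blast
  next
    case False
    then obtain a' b' where ab: "a = Suc a'" "b = Suc b'" by (meson not0_implies_Suc)
    then have "2 \<le> card S" using less.prems(2) by simp
    then obtain A B D where S: "S = A \<union> B" "A \<inter> B = {}" "A \<noteq> {}" "B \<noteq> {}"
      and AB: "\<And>x y. x \<in> A \<Longrightarrow> y \<in> B \<Longrightarrow> x < y \<and> delta x y = D"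
      and A: "\<And>x y. x \<in> A \<Longrightarrow> y \<in> A \<Longrightarrow> x < y \<Longrightarrow> delta x y < D"
      and B: "\<And>x y. x \<in> B \<Longrightarrow> y \<in> B \<Longrightarrow> x < y \<Longrightarrow> delta x y < D"
      by (rule delta_split[OF less.prems(1)]) blast
    have fin: "finite A" "finite B" using less.prems(1) S(1) by auto
    have card: "card S = card A + card B" using S fin by (simp add: card_Un_disjoint)
    have pos: "card A > 0" "card B > 0" using S fin by (auto simp: card_gt_0_iff)
    have recA: ?thesis if "a' * b < card A"
    proof -
      have "?I A a' \<or> ?J A b \<or> has_pattern i A"
        using less.hyps[of A a' b] that card pos fin by simp
      moreover have "?I S a" if "?I A a'"
      proof -
        obtain C where C: "C \<subseteq> A" "card C = Suc a'" "inc_delta C" using \<open>?I A a'\<close> by blast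
        obtain y where y: "y \<in> B" using S by auto
        have "y \<notin> C" using C y S by auto
        then have "card (insert y C) = Suc a" using C fin ab by (simp add: finite_subset card_insert_if)
        moreover have "inc_delta (insert y C)"
          unfolding inc_delta_def
        proof (intro ballI impI)
          fix u v w assume u: "u \<in> insert y C" "v \<in> insert y C" "w \<in> insert y C" "u < v \<and> v < w"
          have "\<forall>x\<in>C. x < y" using AB y C by blast
          then have uv: "u \<in> C" "v \<in> C" using u by (metis insertE less_asym order_less_trans)+
          then show "delta u v < delta v w"
          proof (cases "w = y")
            case True
            then show ?thesis using AB[of v y] A[of u v] y uv C u by auto
          next
            case False
            then show ?thesis using C uv u unfolding inc_delta_def by blast
          qed
        qed
        moreover have "insert y C \<subseteq> S" using C y S by auto
        ultimately show ?thesis by blast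
      qed
      moreover have "?J S b" if "?J A b" using that S(1) by blast
      moreover have "has_pattern i S" if "has_pattern i A" using that has_pattern_mono S(1) by blast
      ultimately show ?thesis by argo
    qed
    have recB: ?thesis if "a * b' < card B"
    proof -
      have "?I B a \<or> ?J B b' \<or> has_pattern i B"
        using less.hyps[of B a b'] that card pos fin by simp
      moreover have "?J S b" if "?J B b'"
      proof -
        obtain C where C: "C \<subseteq> B" "card C = Suc b'" "dec_delta C" using \<open>?J B b'\<close> by blast
        obtain y where y: "y \<in> A" using S by auto
        have "y \<notin> C" using C y S by auto
        then have "card (insert y C) = Suc b" using C fin ab by (simp add: finite_subset card_insert_if)
        moreover have "dec_delta (insert y C)"
          unfolding dec_delta_def
        proof (intro ballI impI)
          fix u v w assume u: "u \<in> insert y C" "v \<in> insert y C" "w \<in> insert y C" "u < v \<and> v < w"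
          have "\<forall>x\<in>C. y < x" using AB y C by blast
          then have uv: "v \<in> C" "w \<in> C" using u by (metis insertE less_asym order_less_trans)+
          then show "delta v w < delta u v"
          proof (cases "u = y")
            case True
            then show ?thesis using AB[of y v] B[of v w] y uv C u by auto
          next
            case False
            then show ?thesis using C uv u unfolding dec_delta_def by blast
          qed
        qed
        moreover have "insert y C \<subseteq> S" using C y S by auto
        ultimately show ?thesis by blast
      qed
      moreover have "?I S a" if "?I B a" using that S(1) by blast
      moreover have "has_pattern i S" if "has_pattern i B" using that has_pattern_mono S(1) by blast
      ultimately show ?thesis by argo
    qed
    \<comment> \<open>\<open>recA\<close> asks for more than \<open>a * b - b\<close> points in
      \<open>A\<close>, \<open>recB\<close> for more than \<open>a * b - a\<close> in
      \<open>B\<close>. As the two sizes add up to more than \<open>a * b\<close>, one of them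
      applies if a part is a single point, if \<open>card B \<le> b\<close>, or if
      \<open>card A \<le> a\<close>.\<close>
    consider "i = 0" | "i = 1" | "i \<ge> 2" by linarith
    then show ?thesis
    proof cases
      case 1
      show ?thesis
      proof (cases "card A = 1 \<or> card B = 1")
        case True
        then show ?thesis
        proof
          assume "card A = 1"
          then show ?thesis using recB card less.prems(2) ab by (simp add: algebra_simps)
        next
          assume "card B = 1"
          then show ?thesis using recA card less.prems(2) ab by (simp add: algebra_simps)
        qed
      next
        case False
        have two: "\<exists>u\<in>X. \<exists>v\<in>X. u < v" if "finite X" "card X > 0" "card X \<noteq> 1" for X :: "nat set"
        proof -
          have "2 \<le> card X" using that by linarith
          then obtain u v where "u \<in> X" "v \<in> X" "u \<noteq> v" by (metis card_2_iff' obtain_subset_with_card_n subsetD)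
          then show ?thesis by (metis linorder_neqE_nat)
        qed
        obtain w x where w: "w \<in> A" "x \<in> A" "w < x" using two[of A] False fin pos by auto
        obtain y z where y: "y \<in> B" "z \<in> B" "y < z" using two[of B] False fin pos by auto
        have "pattern i w x y z"
          using 1 w y A[of w x] B[of y z] AB[of x y] by simp
        then have "has_pattern i S" using has_patternI[of w S x y z] w y AB[of x y] S(1) by simp
        then show ?thesis by blast
      qed
    next
      case 2
      show ?thesis
      proof (cases "dec_delta B")
        case True
        show ?thesis
        proof (cases "b < card B")
          case True
          then obtain C where "C \<subseteq> B" "card C = Suc b" by (meson Suc_leI obtain_subset_with_card_n)
          moreover from this have "dec_delta C" using \<open>dec_delta B\<close> unfolding dec_delta_def by blast
          ultimately show ?thesis using S(1) by blast
        next
          case False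
          then show ?thesis using recA card less.prems(2) ab by (simp add: algebra_simps)
        qed
      next
        case False
        then obtain x y z where x: "x \<in> B" "y \<in> B" "z \<in> B" "x < y" "y < z" "\<not> delta y z < delta x y"
          unfolding dec_delta_def by blast
        obtain w where w: "w \<in> A" using S by auto
        \<comment> \<open>The step from \<open>w\<close> into \<open>B\<close> has the largest value
          \<open>D\<close>, and the failed descent inside \<open>B\<close> is an ascent because
          adjacent values differ.\<close>
        have "pattern i w x y z"
          using 2 x AB[of w x] B[of y z] w delta_neq[of x y z] by auto
        then have "has_pattern i S" using has_patternI[of w S x y z] w x AB[of w x] S(1) by simp
        then show ?thesis by blast
      qed
    next
      case 3
      show ?thesis
      proof (cases "inc_delta A")
        case True
        show ?thesis
        proof (cases "a < card A")
          case True
          then obtain C where "C \<subseteq> A" "card C = Suc a" by (meson Suc_leI obtain_subset_with_card_n)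
          moreover from this have "inc_delta C" using \<open>inc_delta A\<close> unfolding inc_delta_def by blast
          ultimately show ?thesis using S(1) by blast
        next
          case False
          then show ?thesis using recB card less.prems(2) ab by (simp add: algebra_simps)
        qed
      next
        case False
        then obtain w x y where x: "w \<in> A" "x \<in> A" "y \<in> A" "w < x" "x < y" "\<not> delta w x < delta x y"
          unfolding inc_delta_def by blast
        obtain z where z: "z \<in> B" using S by auto
        \<comment> \<open>Dually, the failed ascent inside \<open>A\<close> is a descent, and the
          step into \<open>B\<close> ends with the largest value \<open>D\<close>.\<close>
        have "pattern i w x y z"
          using 3 x AB[of y z] A[of w x] z delta_neq[of w x y] by auto
        then have "has_pattern i S" using has_patternI[of w S x y z] z x AB[of y z] S(1) by simp
        then show ?thesis by blast
      qed
    qed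
  qed
qed

section \<open>All colours on sets with monotone \<open>delta\<close>\<close>

text \<open>By \<open>delta_trans\<close>, taking all pairs yields no value beyond those of
  consecutive points.\<close>

definition deltas :: "nat set \<Rightarrow> nat set" where
  "deltas e = {delta x y | x y. x \<in> e \<and> y \<in> e \<and> x < y}"

text \<open>Inclusion rather than equality leaves \<open>\<chi>\<close> free to take further values;
  \<open>ramsey_num_greater\<close> recolours them.\<close>

definition polychromatic :: "nat \<Rightarrow> nat \<Rightarrow> nat \<Rightarrow> (nat set \<Rightarrow> nat) \<Rightarrow> bool" where
  "polychromatic k m t \<chi> \<longleftrightarrow> (\<forall>S \<in> [{..<m}]\<^bsup>t\<^esup>. {..<3} \<subseteq> \<chi> ` [S]\<^bsup>k\<^esup>)"

text \<open>Common core of the increasing and decreasing cases. The map \<open>g\<close> sends a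
  point to its \<open>delta\<close> with the pivot \<open>p\<close>; a \<open>k\<close>-set of such
  values with colour \<open>i\<close> is pulled back to \<open>k\<close> points, and adding
  \<open>p\<close> gives the edge.\<close>

lemma pivot_colour:
  assumes C: "C \<in> [{..<2 ^ m}]\<^bsup>Suc t\<^esup>" and p: "p \<in> C"
    and inj: "inj_on g (C - {p})" and less: "g ` (C - {p}) \<subseteq> {..<m}"
    and deltas: "\<And>e. e \<subseteq> C - {p} \<Longrightarrow> deltas (insert p e) = g ` e"
    and \<chi>: "polychromatic k m t \<chi>" and i: "i < 3"
  shows "\<exists>e \<in> [C]\<^bsup>Suc k\<^esup>. \<chi> (deltas e) = i"
proof -
  have "card (C - {p}) = t" "finite C" using C p by (auto simp: nsets_def)
  then have "g ` (C - {p}) \<in> [{..<m}]\<^bsup>t\<^esup>"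
    using less by (simp add: nsets_def card_image[OF inj])
  then have "i \<in> \<chi> ` [g ` (C - {p})]\<^bsup>k\<^esup>"
    using \<chi> i unfolding polychromatic_def by blast
  then obtain f where f: "f \<in> [g ` (C - {p})]\<^bsup>k\<^esup>" "i = \<chi> f" by blast
  then have "f \<subseteq> g ` (C - {p})" by (simp add: nsets_def)
  then obtain e where e: "e \<subseteq> C - {p}" "f = g ` e" by (meson subset_imageE)
  then have "card e = k" using f card_image[OF inj_on_subset[OF inj e(1)]] by (simp add: nsets_def)
  moreover have "finite e" "p \<notin> e" using e \<open>finite C\<close> finite_subset by blast+
  ultimately have "insert p e \<in> [C]\<^bsup>Suc k\<^esup>" using e p by (auto simp: nsets_def)
  then show ?thesis using deltas[OF e(1)] e(2) f(2) by metis
qed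

lemma inc_delta_colour:
  assumes C: "C \<in> [{..<2 ^ m}]\<^bsup>Suc t\<^esup>" "inc_delta C"
    and \<chi>: "polychromatic k m t \<chi>" and i: "i < 3"
  shows "\<exists>e \<in> [C]\<^bsup>Suc k\<^esup>. \<chi> (deltas e) = i"
proof (rule pivot_colour[OF C(1) _ _ _ _ \<chi> i])
  define p where "p = Min C"
  have fin: "finite C" "C \<noteq> {}" using C by (auto simp: nsets_def)
  have p: "p \<in> C" "\<And>x. x \<in> C - {p} \<Longrightarrow> p < x"
    using fin unfolding p_def by (auto simp: order.strict_iff_order)
  \<comment> \<open>With increasing values, \<open>delta\<close> depends only on the larger point,
    so the minimum serves as pivot.\<close>
  have eq: "delta x y = delta p y" if "x \<in> C" "y \<in> C - {p}" "x < y" for x y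
  proof (cases "x = p")
    case False
    then show ?thesis using that p delta_trans[of p x y] C(2) unfolding inc_delta_def
      by (metis DiffD1 DiffI max.absorb2 nat_less_le singletonD)
  qed simp
  have mono: "delta p x < delta p y" if "x \<in> C - {p}" "y \<in> C - {p}" "x < y" for x y
    using that p C(2) eq[of x y] unfolding inc_delta_def by (metis DiffD1)
  show "Min C \<in> C" using fin by simp
  show "inj_on (delta p) (C - {Min C})"
    using mono unfolding p_def inj_on_def by (metis less_irrefl linorder_neqE_nat)
  show "delta p ` (C - {Min C}) \<subseteq> {..<m}"
    using p C(1) by (auto simp: nsets_def p_def intro!: delta_less)
  show "deltas (insert (Min C) e) = delta p ` e" if "e \<subseteq> C - {Min C}" for e
  proof -
    have e: "e \<subseteq> C - {p}" using that by (simp add: p_def)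
    have "deltas (insert p e) = delta p ` e"
    proof (intro equalityI subsetI)
      fix d assume "d \<in> deltas (insert p e)"
      then obtain x y where xy: "d = delta x y" "x \<in> insert p e" "y \<in> insert p e" "x < y"
        by (auto simp: deltas_def)
      then have "x \<in> C" "y \<noteq> p" using e p by force+
      then show "d \<in> delta p ` e" using xy e eq[of x y] by auto
    next
      fix d assume "d \<in> delta p ` e"
      then show "d \<in> deltas (insert p e)" using e p unfolding deltas_def by blast
    qed
    then show ?thesis by (simp add: p_def)
  qed
qed

lemma dec_delta_colour:
  assumes C: "C \<in> [{..<2 ^ m}]\<^bsup>Suc t\<^esup>" "dec_delta C"
    and \<chi>: "polychromatic k m t \<chi>" and i: "i < 3"
  shows "\<exists>e \<in> [C]\<^bsup>Suc k\<^esup>. \<chi> (deltas e) = i"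
proof (rule pivot_colour[OF C(1) _ _ _ _ \<chi> i])
  define p where "p = Max C"
  have fin: "finite C" "C \<noteq> {}" using C by (auto simp: nsets_def)
  have p: "p \<in> C" "\<And>x. x \<in> C - {p} \<Longrightarrow> x < p"
    using fin unfolding p_def by (auto simp: order.strict_iff_order)
  \<comment> \<open>With decreasing values, \<open>delta\<close> depends only on the smaller point,
    so the maximum serves as pivot.\<close>
  have eq: "delta x y = delta x p" if "x \<in> C - {p}" "y \<in> C" "x < y" for x y
  proof (cases "y = p")
    case False
    then show ?thesis using that p delta_trans[of x y p] C(2) unfolding dec_delta_def
      by (metis DiffD1 DiffI max.absorb1 nat_less_le singletonD)
  qed simp
  have mono: "delta y p < delta x p" if "x \<in> C - {p}" "y \<in> C - {p}" "x < y" for x y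
    using that p C(2) eq[of x y] unfolding dec_delta_def by (metis DiffD1)
  show "Max C \<in> C" using fin by simp
  show "inj_on (\<lambda>x. delta x p) (C - {Max C})"
    using mono unfolding p_def inj_on_def by (metis less_irrefl linorder_neqE_nat)
  show "(\<lambda>x. delta x p) ` (C - {Max C}) \<subseteq> {..<m}"
    using p C(1) by (auto simp: nsets_def p_def intro!: delta_less)
  show "deltas (insert (Max C) e) = (\<lambda>x. delta x p) ` e" if "e \<subseteq> C - {Max C}" for e
  proof -
    have e: "e \<subseteq> C - {p}" using that by (simp add: p_def)
    have "deltas (insert p e) = (\<lambda>x. delta x p) ` e"
    proof (intro equalityI subsetI)
      fix d assume "d \<in> deltas (insert p e)"
      then obtain x y where xy: "d = delta x y" "x \<in> insert p e" "y \<in> insert p e" "x < y"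
        by (auto simp: deltas_def)
      then have "y \<in> C" "x \<noteq> p" using e p by force+
      then show "d \<in> (\<lambda>x. delta x p) ` e" using xy e eq[of x y] by auto
    next
      fix d assume "d \<in> (\<lambda>x. delta x p) ` e"
      then show "d \<in> deltas (insert p e)" using e p unfolding deltas_def by blast
    qed
    then show ?thesis by (simp add: p_def)
  qed
qed

section \<open>The stepped-up colouring\<close>

text \<open>Since only the four lowest vertices decide in the second case, higher vertices can be
  appended as padding. Colour 2 also catches edges that start monotonically and break later.\<close>

definition step_up :: "(nat set \<Rightarrow> nat) \<Rightarrow> nat set \<Rightarrow> nat" where
  "step_up \<chi> e =
    (if inc_delta e \<or> dec_delta e then \<chi> (deltas e)
     else case sorted_list_of_set e of
       a # b # c # d # _ \<Rightarrow> (if pattern 0 a b c d then 0 else if pattern 1 a b c d then 1 else 2)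
     | _ \<Rightarrow> 0)"

lemma step_up_pattern:
  assumes less: "a < b" "b < c" "c < d" "\<forall>x\<in>R. d < x" and R: "finite R"
    and pat: "pattern i a b c d" and i: "i < 3"
  shows "step_up \<chi> ({a, b, c, d} \<union> R) = i"
proof -
  let ?e = "{a, b, c, d} \<union> R"
  have "sorted_list_of_set (set (a # b # c # d # sorted_list_of_set R)) =
      a # b # c # d # sorted_list_of_set R"
    using less R by (intro sorted_list_of_set.idem_if_sorted_distinct) fastforce+
  then have list: "sorted_list_of_set (insert a (insert b (insert c (insert d R)))) =
      a # b # c # d # sorted_list_of_set R"
    using R by simp
  have abc: "inc_delta ?e \<Longrightarrow> delta a b < delta b c" "dec_delta ?e \<Longrightarrow> delta b c < delta a b"
    unfolding inc_delta_def dec_delta_def using less by blast+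
  have bcd: "inc_delta ?e \<Longrightarrow> delta b c < delta c d" "dec_delta ?e \<Longrightarrow> delta c d < delta b c"
    unfolding inc_delta_def dec_delta_def using less by blast+
  \<comment> \<open>Each pattern contains both an ascent and a descent.\<close>
  have "\<not> inc_delta ?e \<and> \<not> dec_delta ?e"
    using abc bcd pat by (auto split: if_splits)
  moreover have "i = 0 \<or> i = 1 \<or> i = 2" using i by linarith
  ultimately show ?thesis using pat by (auto simp: step_up_def list)
qed

lemma ex_top_elements:
  fixes S :: "'a::linorder set"
  assumes "finite S" "r \<le> card S"
  shows "\<exists>R\<subseteq>S. card R = r \<and> (\<forall>x\<in>S - R. \<forall>y\<in>R. x < y)"
  using assms
proof (induction r arbitrary: S)
  case (Suc r)
  then have S: "S \<noteq> {}" by auto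
  have "finite (S - {Max S})" "r \<le> card (S - {Max S})" using Suc.prems S by auto
  then obtain R where R: "R \<subseteq> S - {Max S}" "card R = r"
      "\<forall>x\<in>S - {Max S} - R. \<forall>y\<in>R. x < y"
    using Suc.IH by blast
  have "x < Max S" if "x \<in> S - insert (Max S) R" for x
    using that Suc.prems(1) Max_ge[of S x] by (auto simp: order.strict_iff_order)
  moreover have "finite R" "Max S \<notin> R" using R Suc.prems(1) finite_subset by blast+
  ultimately have "insert (Max S) R \<subseteq> S \<and> card (insert (Max S) R) = Suc r \<and>
      (\<forall>x\<in>S - insert (Max S) R. \<forall>y\<in>insert (Max S) R. x < y)"
    using R S Suc.prems(1) by auto
  then show ?case by blast
qed auto

lemma polychromatic_step_up:
  assumes k: "3 \<le> k" and \<chi>: "polychromatic k m t \<chi>"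
  shows "polychromatic (Suc k) (2 ^ m) (t\<^sup>2 + k) (step_up \<chi>)"
  unfolding polychromatic_def
proof (intro ballI subsetI)
  fix S i assume "S \<in> [{..<2 ^ m :: nat}]\<^bsup>(t\<^sup>2 + k)\<^esup>" and "i \<in> {..<3::nat}"
  then have S: "S \<subseteq> {..<2 ^ m}" "finite S" "card S = t\<^sup>2 + k" and i: "i < 3"
    by (auto simp: nsets_def)
  \<comment> \<open>The top \<open>k - 3\<close> points are reserved to complete a four-point
    pattern to \<open>k + 1\<close> vertices. Below them \<open>t\<^sup>2 + 3\<close> points remain,
    enough for \<open>pattern_exists\<close>.\<close>
  have "k - 3 \<le> card S" using S by simp
  then obtain R where R: "R \<subseteq> S" "card R = k - 3" "\<forall>x\<in>S - R. \<forall>y\<in>R. x < y"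
    using ex_top_elements[OF S(2)] by blast
  have finR: "finite R" using R S finite_subset by blast
  have "card (S - R) = card S - card R" using R finR by (simp add: card_Diff_subset)
  then have card: "t * t < card (S - R)" using S R k by (simp add: power2_eq_square)
  have comb: "\<exists>e \<in> [S]\<^bsup>Suc k\<^esup>. step_up \<chi> e = i"
    if C: "C \<subseteq> S - R" "card C = Suc t" "inc_delta C \<or> dec_delta C" for C
  proof -
    have C': "C \<in> [{..<2 ^ m}]\<^bsup>Suc t\<^esup>"
      using C S finite_subset[of C S] by (auto simp: nsets_def)
    obtain e where e: "e \<in> [C]\<^bsup>Suc k\<^esup>" "\<chi> (deltas e) = i"
      using C(3) inc_delta_colour[OF C' _ \<chi> i] dec_delta_colour[OF C' _ \<chi> i] by blast
    have "inc_delta e \<or> dec_delta e"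
      using C(3) e(1) unfolding inc_delta_def dec_delta_def nsets_def by blast
    then have "step_up \<chi> e = i" using e by (simp add: step_up_def)
    moreover have "e \<in> [S]\<^bsup>Suc k\<^esup>" using e C by (auto simp: nsets_def)
    ultimately show ?thesis by blast
  qed
  have "\<exists>e \<in> [S]\<^bsup>Suc k\<^esup>. step_up \<chi> e = i" if pat: "has_pattern i (S - R)"
  proof -
    obtain a b c d where abcd: "a \<in> S - R" "b \<in> S - R" "c \<in> S - R" "d \<in> S - R"
        "a < b" "b < c" "c < d" "pattern i a b c d"
      using pat unfolding has_pattern_def by blast
    have "step_up \<chi> ({a, b, c, d} \<union> R) = i"
      using abcd R finR i by (intro step_up_pattern) auto
    moreover have "card ({a, b, c, d} \<union> R) = card {a, b, c, d} + card R"
      using abcd finR by (intro card_Un_disjoint) auto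
    then have "card ({a, b, c, d} \<union> R) = Suc k" using abcd R k by simp
    then have "{a, b, c, d} \<union> R \<in> [S]\<^bsup>Suc k\<^esup>" using abcd R finR by (auto simp: nsets_def)
    ultimately show ?thesis by blast
  qed
  with comb have "\<exists>e \<in> [S]\<^bsup>Suc k\<^esup>. step_up \<chi> e = i"
    using pattern_exists[of "S - R" t t i] card S(2) by blast
  then show "i \<in> step_up \<chi> ` [S]\<^bsup>Suc k\<^esup>" by blast
qed

section \<open>From colourings to Ramsey numbers\<close>

lemma polychromatic_mono:
  assumes "polychromatic k m t \<chi>" "m' \<le> m" "t \<le> t'"
  shows "polychromatic k m' t' \<chi>"
  unfolding polychromatic_def
proof
  fix S assume "S \<in> [{..<m'}]\<^bsup>t'\<^esup>"
  then have S: "S \<subseteq> {..<m}" "finite S" "t \<le> card S" using assms by (auto simp: nsets_def)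
  then obtain S' where S': "S' \<subseteq> S" "card S' = t" "finite S'" by (meson obtain_subset_with_card_n)
  then have "S' \<in> [{..<m}]\<^bsup>t\<^esup>" using S by (auto simp: nsets_def)
  then have "{..<3} \<subseteq> \<chi> ` [S']\<^bsup>k\<^esup>" using assms(1) by (auto simp: polychromatic_def)
  also have "\<dots> \<subseteq> \<chi> ` [S]\<^bsup>k\<^esup>" using nsets_mono[OF S'(1)] by (rule image_mono)
  finally show "{..<3} \<subseteq> \<chi> ` [S]\<^bsup>k\<^esup>" .
qed

lemma ramsey_num_greater:
  assumes "polychromatic k m t \<chi>"
  shows "m < ramsey_num k t 3 3"
proof (rule ccontr)
  define N where "N = ramsey_num k t 3 3"
  \<comment> \<open>Truncation makes this a colouring with three colours; edges coloured below 3
    keep their colour, so no colour is lost.\<close>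
  define \<chi>' where "\<chi>' = (\<lambda>e. if \<chi> e < 3 then \<chi> e else 0)"
  have "ramsey_arrow k N t 3 3"
    unfolding N_def ramsey_num_def by (rule LeastI_ex[OF ramsey_arrow_exists]) simp
  moreover have "\<chi>' \<in> [{..<N}]\<^bsup>k\<^esup> \<rightarrow> {..<3}" by (auto simp: \<chi>'_def)
  ultimately obtain S where S: "S \<in> [{..<N}]\<^bsup>t\<^esup>" "card (\<chi>' ` [S]\<^bsup>k\<^esup>) < 3"
    unfolding ramsey_arrow_def by blast
  assume "\<not> m < ramsey_num k t 3 3"
  then have "polychromatic k N t \<chi>" using polychromatic_mono[OF assms] N_def by simp
  then have *: "{..<3} \<subseteq> \<chi> ` [S]\<^bsup>k\<^esup>" using S by (auto simp: polychromatic_def)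
  have "i \<in> \<chi>' ` [S]\<^bsup>k\<^esup>" if i: "i < 3" for i
  proof -
    obtain e where "e \<in> [S]\<^bsup>k\<^esup>" "\<chi> e = i" using * i by blast
    then show ?thesis using i by (force simp: \<chi>'_def)
  qed
  then have "{..<3} \<subseteq> \<chi>' ` [S]\<^bsup>k\<^esup>" by auto
  moreover have "finite (\<chi>' ` [S]\<^bsup>k\<^esup>)"
    using S by (intro finite_imageI finite_imp_finite_nsets) (simp add: nsets_def)
  ultimately have "card {..<3::nat} \<le> card (\<chi>' ` [S]\<^bsup>k\<^esup>)" by (intro card_mono)
  then show False using S by simp
qed

section \<open>The random colouring of triples\<close>

text \<open>Uses the bound \<open>(t / 3) ^ 3\<close> for the binomial coefficient;
  \<open>t \<ge> 60\<close> makes \<open>t / 27\<close> exceed 2 with room for the constant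
  term.\<close>

lemma choose_three_ge:
  fixes t :: nat
  assumes "60 \<le> t"
  shows "2 * (t\<^sup>2 + 2) \<le> t choose 3"
proof -
  have t: "60 \<le> real t" using assms by simp
  have "2 * ((real t)\<^sup>2 + 2) \<le> 60 / 27 * (real t)\<^sup>2"
    using power_mono[OF t, of 2] by simp
  also have "\<dots> \<le> real t / 27 * (real t)\<^sup>2"
    using t by (intro mult_right_mono) auto
  also have "\<dots> = (real t / 3) ^ 3" by (simp add: field_simps power2_eq_square power3_eq_cube)
  also have "\<dots> \<le> real (t choose 3)"
    using binomial_ge_n_over_k_pow_k[of 3 t, where 'a = real] assms by simp
  finally have "real (2 * (t\<^sup>2 + 2)) \<le> real (t choose 3)" by simp
  then show ?thesis by (simp only: of_nat_le_iff)
qed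

text \<open>Rests on \<open>8 \<le> 9\<close>. It says that \<open>(2 / 3) ^ C\<close> beats a union
  bound over \<open>2 ^ q\<close> events.\<close>

lemma power_two_le_power_three:
  fixes q C :: nat
  assumes "2 * q \<le> C"
  shows "2 ^ q * 2 ^ C \<le> (3 ^ C :: nat)"
proof -
  obtain r where C: "C = 2 * q + r" using assms le_Suc_ex by blast
  have "(2 ^ q * 2 ^ C :: nat) = 8 ^ q * 2 ^ r"
    by (simp add: C power_add power_mult flip: power_mult_distrib)
  also have "\<dots> \<le> 9 ^ q * 3 ^ r" by (intro mult_mono power_mono) auto
  also have "\<dots> = 3 ^ C" by (simp add: C power_add power_mult)
  finally show ?thesis .
qed

text \<open>The probabilistic method as counting: a fixed \<open>t\<close>-set misses a fixed colour
  in a fraction \<open>(2 / 3) ^ C\<close> of all colourings, and fewer than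
  \<open>2 ^ (t\<^sup>2 + 2)\<close> such pairs exist.\<close>

lemma polychromatic_random:
  assumes t: "60 \<le> t"
  shows "\<exists>\<chi>. polychromatic 3 (2 ^ t) t \<chi>"
proof -
  define V :: "nat set" where "V = {..<2 ^ t}"
  define E where "E = [V]\<^bsup>3\<^esup>"
  define F where "F = E \<rightarrow>\<^sub>E {..<3::nat}"
  define C where "C = t choose 3"
  \<comment> \<open>\<open>bad (S, i)\<close> consists of the colourings that avoid \<open>i\<close>
    on the triples of \<open>S\<close>; as a product set it is counted by
    \<open>card_PiE\<close>.\<close>
  define bad where "bad = (\<lambda>(S, i). \<Pi>\<^sub>E e\<in>E. if e \<in> [S]\<^bsup>3\<^esup> then {..<3} - {i} else {..<3::nat})"
  define I where "I = [V]\<^bsup>t\<^esup> \<times> {..<3::nat}"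
  have finV: "finite V" by (simp add: V_def)
  have finE: "finite E" unfolding E_def using finV by (rule finite_imp_finite_nsets)
  have finI: "finite I" unfolding I_def using finite_imp_finite_nsets[OF finV] by simp
  have card_bad: "card (bad p) * 3 ^ C = 2 ^ C * card F" if "p \<in> I" for p
  proof -
    obtain S i where p: "p = (S, i)" "S \<in> [V]\<^bsup>t\<^esup>" "i < 3" using \<open>p \<in> I\<close> by (auto simp: I_def)
    have sub: "[S]\<^bsup>3\<^esup> \<subseteq> E" unfolding E_def using p by (intro nsets_mono) (simp add: nsets_def)
    have cardS: "card ([S]\<^bsup>3\<^esup>) = C" using p(2) by (simp add: C_def) (simp add: nsets_def)
    have "card (bad p) = (\<Prod>e\<in>E. card (if e \<in> [S]\<^bsup>3\<^esup> then {..<3} - {i} else {..<3::nat}))"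
      using finE by (simp add: bad_def p card_PiE)
    also have "\<dots> = (\<Prod>e\<in>E. if e \<in> [S]\<^bsup>3\<^esup> then 2 else 3)"
      using p by (intro prod.cong) auto
    also have "\<dots> = 2 ^ C * 3 ^ card (E - [S]\<^bsup>3\<^esup>)"
    proof -
      have "E \<inter> {e. e \<in> [S]\<^bsup>3\<^esup>} = [S]\<^bsup>3\<^esup>" "E \<inter> - {e. e \<in> [S]\<^bsup>3\<^esup>} = E - [S]\<^bsup>3\<^esup>"
        using sub by auto
      then show ?thesis using finE cardS by (simp only: prod.If_cases prod_constant)
    qed
    finally have "card (bad p) * 3 ^ C = 2 ^ C * 3 ^ (card (E - [S]\<^bsup>3\<^esup>) + C)"
      by (simp add: power_add)
    also have "card (E - [S]\<^bsup>3\<^esup>) + C = card E"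
      using sub finE cardS by (metis card_Diff_subset card_mono finite_subset le_add_diff_inverse2)
    also have "3 ^ card E = card F" using finE by (simp add: F_def card_PiE)
    finally show ?thesis .
  qed
  have "card I \<le> 3 * 2 ^ t\<^sup>2"
  proof -
    have "card I = (2 ^ t choose t) * 3"
      by (simp add: I_def V_def card_cartesian_product)
    also have "\<dots> \<le> (2 ^ t) ^ t * 3"
      using binomial_le_pow[of t "2 ^ t"] less_exp[of t] by simp
    finally show ?thesis by (simp add: power2_eq_square power_mult mult.commute)
  qed
  also have "\<dots> < 2 ^ (t\<^sup>2 + 2)" by (simp add: power_add)
  finally have "card I < 2 ^ (t\<^sup>2 + 2)" .
  have "card F > 0" using finE by (simp add: F_def card_PiE)
  \<comment> \<open>Union bound, scaled by \<open>3 ^ C\<close> to stay within natural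
    numbers.\<close>
  have "card (\<Union>p\<in>I. bad p) * 3 ^ C \<le> (\<Sum>p\<in>I. card (bad p)) * 3 ^ C"
    using card_UN_le[OF finI] by simp
  also have "\<dots> = (\<Sum>p\<in>I. 2 ^ C * card F)"
    using card_bad by (simp add: sum_distrib_right)
  also have "\<dots> = card I * 2 ^ C * card F" by simp
  also have "\<dots> < 2 ^ (t\<^sup>2 + 2) * 2 ^ C * card F"
    using \<open>card I < _\<close> \<open>card F > 0\<close> by simp
  also have "\<dots> \<le> 3 ^ C * card F"
    using power_two_le_power_three[OF choose_three_ge[OF t]] by (simp add: C_def)
  finally have "card (\<Union>p\<in>I. bad p) < card F" by simp
  moreover have "finite (\<Union>p\<in>I. bad p)"
    using finI finE by (auto simp: bad_def intro!: finite_PiE)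
  ultimately obtain \<chi> where \<chi>: "\<chi> \<in> F" "\<chi> \<notin> (\<Union>p\<in>I. bad p)"
    by (meson card_mono leD subsetI)
  have "i \<in> \<chi> ` [S]\<^bsup>3\<^esup>" if "S \<in> [V]\<^bsup>t\<^esup>" "i < 3" for S i
  proof (rule ccontr)
    assume "i \<notin> \<chi> ` [S]\<^bsup>3\<^esup>"
    then have "\<chi> \<in> bad (S, i)" using \<chi>(1) by (auto simp: bad_def F_def PiE_iff)
    then show False using \<chi>(2) that by (auto simp: I_def)
  qed
  then have "polychromatic 3 (2 ^ t) t \<chi>" by (auto simp: polychromatic_def V_def)
  then show ?thesis by blast
qed

section \<open>Iterated stepping up\<close>

text \<open>Each step adds one exponential to \<open>m\<close> and triples the exponent
  \<open>r\<close>, starting from \<open>r = 1\<close> and \<open>2 ^ t\<close> points at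
  \<open>k = 3\<close>.\<close>

lemma polychromatic_tower:
  assumes "3 \<le> k"
  shows "\<exists>r\<ge>1. \<forall>\<^sub>F t in sequentially.
    \<exists>m \<chi>. real m = tower (k - 1) (real t) \<and> polychromatic k m (t ^ r) \<chi>"
  using assms
proof (induction k rule: nat_induct_at_least)
  case base
  have "real (2 ^ t) = tower (3 - 1) (real t)" for t
    by (simp add: numeral_2_eq_2 numeral_3_eq_3 powr_realpow)
  then have "\<forall>\<^sub>F t in sequentially.
      \<exists>m \<chi>. real m = tower (3 - 1) (real t) \<and> polychromatic 3 m (t ^ 1) \<chi>"
    using polychromatic_random by (intro eventually_sequentiallyI[of 60]) (metis power_one_right)
  then show ?case by blast
next
  case (Suc k)
  then obtain r where r: "1 \<le> r" and ev: "\<forall>\<^sub>F t in sequentially.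
      \<exists>m \<chi>. real m = tower (k - 1) (real t) \<and> polychromatic k m (t ^ r) \<chi>"
    by blast
  have "\<forall>\<^sub>F t in sequentially.
      \<exists>m \<chi>. real m = tower (Suc k - 1) (real t) \<and> polychromatic (Suc k) m (t ^ (r * 3)) \<chi>"
    \<comment> \<open>\<open>t \<ge> k + 2\<close> gives \<open>u \<ge> k\<close> and
      \<open>u \<ge> 2\<close> for \<open>u = t ^ r\<close>, so that \<open>u\<^sup>2 + k\<close> is
      at most twice \<open>u\<^sup>2\<close>, hence at most \<open>u ^ 3\<close>.\<close>
    using ev eventually_ge_at_top[of "k + 2"]
  proof eventually_elim
    case (elim t)
    then obtain m \<chi> where m: "real m = tower (k - 1) (real t)" "polychromatic k m (t ^ r) \<chi>"
      by blast
    define u where "u = t ^ r"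
    have "t ^ 1 \<le> u" unfolding u_def using elim r by (intro power_increasing) auto
    then have u: "k \<le> u" "2 \<le> u" using elim by auto
    have "u\<^sup>2 + k \<le> u * u + u * u" using u by (simp add: power2_eq_square le_square le_trans)
    also have "\<dots> = 2 * (u * u)" by simp
    also have "\<dots> \<le> u * (u * u)" using u by (intro mult_right_mono) auto
    also have "\<dots> = t ^ (r * 3)" by (simp add: u_def power_mult power3_eq_cube)
    finally have "polychromatic (Suc k) (2 ^ m) (t ^ (r * 3)) (step_up \<chi>)"
      unfolding u_def by (rule polychromatic_mono[OF polychromatic_step_up[OF Suc.hyps m(2)] order.refl])
    moreover have "real (2 ^ m) = tower (Suc k - 1) (real t)"
    proof -
      have j: "k = Suc (Suc (k - 2))" using Suc.hyps by simp
      have "tower (Suc k - 1) (real t) = 2 powr real m" using m(1) by (subst j, subst (asm) j) simp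
      then show ?thesis by (simp add: powr_realpow)
    qed
    ultimately show ?case by blast
  qed
  then show ?case using r by (intro exI[of _ "r * 3"]) simp
qed

section \<open>From perfect powers to all large \<open>t\<close>\<close>

lemma tower_mono: "x \<le> y \<Longrightarrow> tower (Suc i) x \<le> tower (Suc i) y"
  by (induction i) auto

theorem corollary1p5:
  fixes k :: nat
  assumes "k \<ge> 4"
  shows "\<exists>c::real. c > 0 \<and>
    (\<forall>\<^sub>F t in sequentially. real (ramsey_num k t 3 3) \<ge> tower (k - 1) (real t powr c))"
proof -
  obtain r where r: "1 \<le> r" and ev: "\<forall>\<^sub>F t in sequentially.
      \<exists>m \<chi>. real m = tower (k - 1) (real t) \<and> polychromatic k m (t ^ r) \<chi>"
    using polychromatic_tower[of k] assms by auto
  \<comment> \<open>The construction is used at \<open>s t\<close>, the integer part of the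
    \<open>r\<close>-th root of \<open>t\<close>. Halving the exponent \<open>1 / r\<close> absorbs
    the rounding.\<close>
  define c :: real where "c = 1 / (2 * real r)"
  define s where "s t = nat \<lfloor>real t powr (1 / real r)\<rfloor>" for t
  have c: "c > 0" using r by (simp add: c_def)
  have pow_le: "s t ^ r \<le> t" for t
  proof -
    have "real (s t) \<le> real t powr (1 / real r)" by (simp add: s_def)
    then have "real (s t) ^ r \<le> (real t powr (1 / real r)) ^ r" by (intro power_mono) auto
    also have "\<dots> \<le> real t" using r by (cases "t = 0") (auto simp: powr_powr zero_power simp flip: powr_realpow)
    finally show ?thesis by (simp flip: of_nat_power)
  qed
  have large: "\<forall>\<^sub>F t in sequentially. Z \<le> real t powr c" if "Z \<ge> 0" for Z
    using eventually_ge_at_top[of "nat \<lceil>Z powr (1 / c)\<rceil>"]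
  proof eventually_elim
    case (elim t)
    then have "Z powr (1 / c) \<le> real t" by linarith
    then have "(Z powr (1 / c)) powr c \<le> real t powr c" using c by (intro powr_mono2) auto
    then show ?case using c that by (simp add: powr_powr)
  qed
  have s_ge: "\<forall>\<^sub>F t in sequentially. real t powr c \<le> real (s t)"
    using large[of 2, simplified]
  proof eventually_elim
    case (elim t)
    define u where "u = real t powr c"
    have "real t powr (1 / real r) = u * u" by (simp add: u_def c_def flip: powr_add)
    \<comment> \<open>For \<open>u \<ge> 2\<close>, rounding \<open>u * u\<close> down costs less
      than 1 and so leaves at least \<open>u\<close>.\<close>
    moreover have "2 * u \<le> u * u" using elim by (intro mult_right_mono) (auto simp: u_def)
    ultimately have "u \<le> real (s t)" unfolding s_def using elim u_def by linarith
    then show ?case by (simp add: u_def)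
  qed
  \<comment> \<open>Divergence of \<open>s\<close> carries the eventual statement \<open>ev\<close>
    over to the values \<open>s t\<close>.\<close>
  have "filterlim s at_top sequentially"
    unfolding filterlim_at_top
  proof
    fix N
    show "\<forall>\<^sub>F t in sequentially. N \<le> s t"
      using large[of "real N", simplified] s_ge by eventually_elim linarith
  qed
  then have "\<forall>\<^sub>F t in sequentially.
      \<exists>m \<chi>. real m = tower (k - 1) (real (s t)) \<and> polychromatic k m (s t ^ r) \<chi>"
    using ev by (rule eventually_compose_filterlim[rotated])
  then have "\<forall>\<^sub>F t in sequentially. real (ramsey_num k t 3 3) \<ge> tower (k - 1) (real t powr c)"
    using s_ge
  proof eventually_elim
    case (elim t)
    then obtain m \<chi> where m: "real m = tower (k - 1) (real (s t))" "polychromatic k m (s t ^ r) \<chi>"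
      by blast
    obtain i where "k - 1 = Suc i" using assms by (cases "k - 1") auto
    then have "tower (k - 1) (real t powr c) \<le> real m" using tower_mono elim(2) m(1) by simp
    also have "\<dots> \<le> real (ramsey_num k t 3 3)"
      using ramsey_num_greater[OF polychromatic_mono[OF m(2) order.refl pow_le]] by simp
    finally show ?case .
  qed
  then show ?thesis using c by blast
qed

end
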